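(* Let $n\ge2$, $A\in\mathbb{R}^{n\times n}$, $C\in\mathbb{R}^{1\times n}$, and suppose $(C,A)$ is observable, i.e. $\operatorname{rank}[C^T\ A^TC^T\ \cdots\ (A^{n-1})^TC^T]=n$. Let $S_0:=\mathcal{N}(C)$ and $S_k:=AS_{k-1}\cap S_0$ for $k\ge1$. Then the system $$\hat x^+ = A\big((\hat x+AS_{n-2})\cap(x+S_0)\big),$$ i.e. $\hat x^+\in g(\hat x,y):=A\big((\hat x+AS_{n-2})\cap\{\eta\in\mathbb{R}^n: C\eta=y\}\big)$ with $y=Cx$, is a deadbeat observer for $x^+=Ax$, $y=Cx$.
   Context: $AS:=\{As:s\in S\}$ and $\hat x+S:=\{\hat x+s:s\in S\}$. Solutions: $\phi(0,x)=x$, $\phi(k+1,x)=A\phi(k,x)$. Given $g:\mathbb{R}^n\times\mathbb{R}\rightrightarrows\mathbb{R}^n$, a solution of $\hat x^+\in g(\hat x,Cx)$ driven by $x^+=Ax$ is any sequence $\psi(k,\hat x,x)$ with $\psi(0,\hat x,x)=\hat x$, $\psi(k+1,\hat x,x)\in g(\psi(k,\hat x,x),C\phi(k,x))$. The system $\hat x^+\in g(\hat x,y)$ is a deadbeat observer if there is $p\ge1$ such that all such solutions satisfy $\psi(k,\hat x,x)=\phi(k,x)$ for all $x,\hat x\in\mathbb{R}^n$ and all $k\ge p$. *)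

theory Defs
  imports "HOL-Analysis.Analysis"
begin

text \<open>Matrix power (note: the ring power on vec types is componentwise, so we define it explicitly).\<close>
definition mpow :: "real^'n^'n \<Rightarrow> nat \<Rightarrow> real^'n^'n" where
  "mpow A k = (((**) A) ^^ k) (mat 1)"

text \<open>Output matrix C in R^{1 x n} is represented by the vector c, with C x = c \<bullet> x.
  Observability: rank [C^T, A^T C^T, ..., (A^{n-1})^T C^T] = n; the rank of a matrix is the
  dimension of the span of its columns, so this is the dimension of the set of these columns.\<close>
definition observable :: "real^'n^'n \<Rightarrow> real^'n \<Rightarrow> bool" where
  "observable A c \<longleftrightarrow> dim {transpose (mpow A k) *v c | k. k < CARD('n)} = CARD('n)"

fun Sseq :: "real^'n^'n \<Rightarrow> real^'n \<Rightarrow> nat \<Rightarrow> (real^'n) set" where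
  "Sseq A c 0 = {v. c \<bullet> v = 0}"
| "Sseq A c (Suc k) = ((\<lambda>v. A *v v) ` Sseq A c k) \<inter> Sseq A c 0"

definition phi :: "real^'n^'n \<Rightarrow> nat \<Rightarrow> real^'n \<Rightarrow> real^'n" where
  "phi A k x = mpow A k *v x"

definition observer_solution ::
  "real^'n^'n \<Rightarrow> real^'n \<Rightarrow> (real^'n \<Rightarrow> real \<Rightarrow> (real^'n) set)
     \<Rightarrow> real^'n \<Rightarrow> real^'n \<Rightarrow> (nat \<Rightarrow> real^'n) \<Rightarrow> bool" where
  "observer_solution A c g xh x psi \<longleftrightarrow>
     psi 0 = xh \<and> (\<forall>k. psi (Suc k) \<in> g (psi k) (c \<bullet> phi A k x))"

definition deadbeat_observer ::
  "real^'n^'n \<Rightarrow> real^'n \<Rightarrow> (real^'n \<Rightarrow> real \<Rightarrow> (real^'n) set) \<Rightarrow> bool" where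
  "deadbeat_observer A c g \<longleftrightarrow>
     (\<exists>p\<ge>1. \<forall>x xh psi. observer_solution A c g xh x psi \<longrightarrow>
        (\<forall>k\<ge>p. psi k = phi A k x))"

definition g_obs :: "real^'n^'n \<Rightarrow> real^'n \<Rightarrow> real^'n \<Rightarrow> real \<Rightarrow> (real^'n) set" where
  "g_obs A c xh y = (\<lambda>v. A *v v) `
     (((\<lambda>s. xh + s) ` ((\<lambda>v. A *v v) ` Sseq A c (CARD('n) - 2))) \<inter> {\<eta>. c \<bullet> \<eta> = y})"

end

theory Submission
  imports Defs
begin

(* For an observer built from the subspace S_m, i.e. the map
     obs_map m (xh, y) = A((xh + A S_m) \<inter> {\<eta>. C \<eta> = y}),
   write the estimation error as  psi (k+1) - phi (k+1) x = A u_k, where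
   u_k = (psi k - phi k x) + A w_k with w_k \<in> S_m is the error right after the
   correction step.  Every u_k lies in N(C), and u_{k+1} = A(u_k + w_{k+1});
   since the S_j are nested subspaces, induction gives u_k \<in> S_(min k (m+1)).
   Hence if S_(m+1) = {0}, the error vanishes from step m+2 on: the observer is
   deadbeat.  Finally, a vector of S_(n-1) has the form A^(n-1) w with
   C A^j w = 0 for all j < n; observability forces w = 0, so S_(n-1) = {0},
   and the frozen observer g_obs is obs_map (n-2). *)

lemma mpow_Suc: "mpow A (Suc k) = A ** mpow A k"
  by (simp add: mpow_def)

lemma phi_0: "phi A 0 x = x"
  by (simp add: phi_def mpow_def)

lemma phi_Suc: "phi A (Suc k) x = A *v phi A k x"
  by (simp add: phi_def mpow_Suc matrix_vector_mul_assoc)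

lemma Sseq_subspace: "subspace (Sseq A c k)"
proof (induction k)
  case 0
  show ?case by (simp add: subspace_def inner_add_right)
next
  case (Suc k)
  have "subspace ((\<lambda>v. A *v v) ` Sseq A c k)"
    using Suc linear_subspace_image matrix_vector_mul_linear by blast
  moreover have "subspace (Sseq A c 0)"
    by (simp add: subspace_def inner_add_right)
  ultimately show ?case by (simp add: subspace_inter)
qed

lemma Sseq_Suc_subset: "Sseq A c (Suc k) \<subseteq> Sseq A c k"
proof (induction k)
  case 0
  show ?case by auto
next
  case (Suc k)
  then show ?case
    by (auto simp del: Sseq.simps(1)
             simp: Sseq.simps(2)[of A c "Suc k"] Sseq.simps(2)[of A c k])
qed

lemma Sseq_antimono: "i \<le> j \<Longrightarrow> Sseq A c j \<subseteq> Sseq A c i"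
  by (induction j rule: dec_induct) (use Sseq_Suc_subset in blast)+

lemma Sseq_unfold:
  assumes "v \<in> Sseq A c k"
  shows "\<exists>w. v = mpow A k *v w \<and> (\<forall>j\<le>k. c \<bullet> (mpow A j *v w) = 0)"
  using assms
proof (induction k arbitrary: v)
  case 0
  then show ?case by (intro exI[of _ v]) (simp add: mpow_def)
next
  case (Suc k)
  then obtain v' where v': "v = A *v v'" "v' \<in> Sseq A c k" "c \<bullet> v = 0"
    by auto
  then obtain w where w: "v' = mpow A k *v w" "\<forall>j\<le>k. c \<bullet> (mpow A j *v w) = 0"
    using Suc.IH by blast
  have v_eq: "v = mpow A (Suc k) *v w"
    using v' w by (simp add: mpow_Suc matrix_vector_mul_assoc)
  have "c \<bullet> (mpow A j *v w) = 0" if "j \<le> Suc k" for j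
    using that w v' v_eq by (cases "j = Suc k") auto
  with v_eq show ?case by blast
qed

(* Observability: no nonzero initial state produces the zero output
   C A^j w on the first n steps, because the vectors (A^j)^T C^T span R^n. *)
lemma observable_zero_output:
  assumes obs: "observable A c"
    and out: "\<forall>j<CARD('n). c \<bullet> (mpow A j *v w) = 0"
  shows "w = (0::real^'n)"
proof -
  let ?B = "{transpose (mpow A k) *v c | k. k < CARD('n)}"
  have "dim ?B = DIM(real^'n)" using obs unfolding observable_def by simp
  then have span_B: "span ?B = UNIV" by (rule dim_eq_full[THEN iffD1])
  have "orthogonal w y" if y_B: "y \<in> ?B" for y
  proof -
    obtain k where k: "y = transpose (mpow A k) *v c" "k < CARD('n)"
      using y_B by blast
    then have "c \<bullet> (mpow A k *v w) = 0" using out by simp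
    then show ?thesis
      using k(1) dot_lmul_matrix[of c "mpow A k" w]
      by (simp add: orthogonal_def inner_commute[of w])
  qed
  then have "orthogonal w w"
    using orthogonal_to_span[of w ?B w] span_B by blast
  then show ?thesis by (simp add: orthogonal_def)
qed

lemma observable_Sseq_last:
  assumes "observable A c"
  shows "Sseq A c (CARD('n) - 1) = {0::real^'n}"
proof
  show "Sseq A c (CARD('n) - 1) \<subseteq> {0}"
  proof
    fix v assume "v \<in> Sseq A c (CARD('n) - 1)"
    then obtain w where w: "v = mpow A (CARD('n) - 1) *v w"
        "\<forall>j\<le>CARD('n) - 1. c \<bullet> (mpow A j *v w) = 0"
      using Sseq_unfold by blast
    have "\<forall>j<CARD('n). c \<bullet> (mpow A j *v w) = 0"
      using w(2) by (simp add: less_Suc_eq_le)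
    then have "w = 0" using observable_zero_output[OF assms] by blast
    then show "v \<in> {0}" using w(1) by simp
  qed
  show "{0} \<subseteq> Sseq A c (CARD('n) - 1)"
    using Sseq_subspace subspace_0 by blast
qed

definition obs_map :: "real^'n^'n \<Rightarrow> real^'n \<Rightarrow> nat \<Rightarrow> real^'n \<Rightarrow> real \<Rightarrow> (real^'n) set" where
  "obs_map A c m xh y = (\<lambda>v. A *v v) `
     (((\<lambda>s. xh + s) ` ((\<lambda>v. A *v v) ` Sseq A c m)) \<inter> {\<eta>. c \<bullet> \<eta> = y})"

lemma g_obs_eq_obs_map:
  fixes A :: "real^'n^'n"
  shows "g_obs A c = obs_map A c (CARD('n) - 2)"
  by (simp add: fun_eq_iff g_obs_def obs_map_def)

lemma obs_map_error:
  assumes sol: "observer_solution A c (obs_map A c m) xh x psi"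
  obtains u where "\<And>k. psi (Suc k) - phi A (Suc k) x = A *v u k"
    and "\<And>k. u k \<in> Sseq A c (min k (Suc m))"
proof -
  have "\<exists>w. w \<in> Sseq A c m \<and> psi (Suc k) = A *v (psi k + A *v w)
          \<and> c \<bullet> (psi k + A *v w) = c \<bullet> phi A k x" for k
  proof -
    have "psi (Suc k) \<in> obs_map A c m (psi k) (c \<bullet> phi A k x)"
      using sol by (simp add: observer_solution_def)
    then show ?thesis unfolding obs_map_def by auto
  qed
  then obtain W where W_S: "\<And>k. W k \<in> Sseq A c m"
    and psi_Suc: "\<And>k. psi (Suc k) = A *v (psi k + A *v W k)"
    and out_eq: "\<And>k. c \<bullet> (psi k + A *v W k) = c \<bullet> phi A k x"
    by metis
  define u where "u k = psi k - phi A k x + A *v W k" for k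
  have err: "psi (Suc k) - phi A (Suc k) x = A *v u k" for k
    by (simp add: u_def psi_Suc phi_Suc algebra_simps)
  have u_ker: "c \<bullet> u k = 0" for k
    using out_eq[of k] by (simp add: u_def inner_diff_right inner_add_right)
  have "u k \<in> Sseq A c (min k (Suc m))" for k
  proof (induction k)
    case 0
    show ?case using u_ker[of 0] by simp
  next
    case (Suc k)
    define i where "i = min k m"
    have "i \<le> min k (Suc m)" by (simp add: i_def)
    then have "u k \<in> Sseq A c i" using Suc Sseq_antimono by blast
    moreover have "W (Suc k) \<in> Sseq A c i"
      using W_S Sseq_antimono[of i m] unfolding i_def by auto
    ultimately have "u k + W (Suc k) \<in> Sseq A c i"
      using Sseq_subspace subspace_add by blast
    moreover have "u (Suc k) = A *v (u k + W (Suc k))"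
      using err[of k] by (simp add: u_def matrix_vector_right_distrib)
    ultimately have "u (Suc k) \<in> Sseq A c (Suc i)"
      using u_ker[of "Suc k"] by auto
    then show ?case by (simp add: i_def)
  qed
  with err that show ?thesis by blast
qed

lemma obs_map_deadbeat:
  assumes "Sseq A c (Suc m) = {0}"
  shows "deadbeat_observer A c (obs_map A c m)"
  unfolding deadbeat_observer_def
proof (intro exI[of _ "Suc (Suc m)"] conjI allI impI)
  fix x xh psi k
  assume sol: "observer_solution A c (obs_map A c m) xh x psi"
    and k: "Suc (Suc m) \<le> k"
  obtain u where err: "\<And>k. psi (Suc k) - phi A (Suc k) x = A *v u k"
    and u_S: "\<And>k. u k \<in> Sseq A c (min k (Suc m))"
    using obs_map_error[OF sol] by blast
  obtain k' where k': "k = Suc k'" "Suc m \<le> k'"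
    using k by (cases k) auto
  then have "u k' \<in> Sseq A c (Suc m)" using u_S[of k'] by (simp add: min_absorb2)
  then have "u k' = 0" using assms by blast
  then show "psi k = phi A k x" using err[of k'] k'(1) by simp
qed simp

theorem corollary1:
  fixes A :: "real^'n^'n" and c :: "real^'n"
  assumes "CARD('n) \<ge> 2"
    and "observable A c"
  shows "deadbeat_observer A c (g_obs A c)"
proof -
  have "Suc (CARD('n) - 2) = CARD('n) - 1" using assms(1) by simp
  then have "Sseq A c (Suc (CARD('n) - 2)) = {0}"
    using observable_Sseq_last[OF assms(2)] by simp
  then show ?thesis
    unfolding g_obs_eq_obs_map by (rule obs_map_deadbeat)
qed

end
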